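(* Let $d\geq 1$ and let $P\subset\mathbb{R}^{d}$ be a convex polytope which is simple and rational. Then $P$ has an infinite set of orthogonal exponentials, i.e., there exists an infinite countable set $\Lambda\subset\mathbb{R}^{d}$ such that $\int_{P}e^{i\langle\lambda-\lambda',x\rangle}\,dx=0$ for all $\lambda,\lambda'\in\Lambda$ with $\lambda\neq\lambda'$.
   Context: A convex polytope in $\mathbb{R}^{d}$ is the convex hull of a finite set of points having positive Lebesgue measure. It is simple if each vertex is connected (by an edge) to exactly $d$ other vertices, and rational if every vertex has only rational coordinates. $\langle\cdot,\cdot\rangle$ is the standard scalar product. *)

theory Defs
  imports "HOL-Analysis.Analysis"
begin

definition convex_polytope :: "(real ^ 'n) set \<Rightarrow> bool" where
  "convex_polytope P \<longleftrightarrow> polytope P \<and> emeasure lborel P > 0"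

definition joined_by_edge :: "(real ^ 'n) set \<Rightarrow> real ^ 'n \<Rightarrow> real ^ 'n \<Rightarrow> bool" where
  "joined_by_edge P v w \<longleftrightarrow> closed_segment v w edge_of P"

definition simple_polytope :: "(real ^ 'n) set \<Rightarrow> bool" where
  "simple_polytope P \<longleftrightarrow>
     (\<forall>v. v extreme_point_of P \<longrightarrow>
        card {w. w extreme_point_of P \<and> w \<noteq> v \<and> joined_by_edge P v w} = CARD('n))"

definition rational_polytope :: "(real ^ 'n) set \<Rightarrow> bool" where
  "rational_polytope P \<longleftrightarrow> (\<forall>v. v extreme_point_of P \<longrightarrow> (\<forall>i. v $ i \<in> \<rat>))"

end

theory Submission
  imports Defs
begin

text \<open>
  If a simplex \<open>T\<close> has vertices with pairwise distinct values \<open>\<xi> \<bullet> v\<close> and \<open>exp (\<i> (\<xi> \<bullet> v)) = 1\<close> at every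
  vertex, then \<open>exp (\<i> (\<xi> \<bullet> x))\<close> integrates to zero over \<open>T\<close>: up to a constant the integral is the
  divided difference of \<open>exp\<close> at the nodes \<open>\<i> (\<xi> \<bullet> v)\<close>, where \<open>exp\<close> agrees with the constant \<open>1\<close>.
  A polytope is triangulated without new vertices, by taking for each point the lexicographically
  least barycentric representation; so the same conclusion holds for the polytope. When the vertices
  are rational, choose an integer vector \<open>u\<close> separating them and a common denominator \<open>q\<close> of the
  numbers \<open>u \<bullet> v\<close>; all nonzero integer multiples of \<open>2 \<pi> q u\<close> then satisfy the two conditions on \<open>\<xi>\<close>.
\<close>

section \<open>Triangulation without new vertices\<close>

text \<open>Positivity for the lexicographic order on coefficient functions, the index of smallest
  rank \<open>r\<close> deciding first. \<open>lex_pos\<close> of \<open>v - u\<close> thus says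
  that \<open>u\<close> comes strictly before \<open>v\<close>.\<close>

definition lex_pos :: "('a \<Rightarrow> nat) \<Rightarrow> 'a set \<Rightarrow> ('a \<Rightarrow> real) \<Rightarrow> bool" where
  "lex_pos r S f \<longleftrightarrow> (\<exists>k\<in>S. f k > 0 \<and> (\<forall>j\<in>S. r j < r k \<longrightarrow> f j = 0))"

lemma lex_pos_scale: "lex_pos r S (\<lambda>x. c * f x) \<longleftrightarrow> lex_pos r S f" if "c > 0"
  using that by (simp add: lex_pos_def zero_less_mult_iff)

text \<open>The leading entry of the sum is the earlier of the two leading entries, or their sum if
  they sit at the same index. Applied to differences, this is transitivity of the order.\<close>

lemma lex_pos_add:
  assumes "inj_on r S" "lex_pos r S f" "lex_pos r S g"
  shows "lex_pos r S (\<lambda>x. f x + g x)"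
proof -
  obtain k where k: "k \<in> S" "f k > 0" "\<forall>j\<in>S. r j < r k \<longrightarrow> f j = 0"
    using assms(2) by (auto simp: lex_pos_def)
  obtain l where l: "l \<in> S" "g l > 0" "\<forall>j\<in>S. r j < r l \<longrightarrow> g j = 0"
    using assms(3) by (auto simp: lex_pos_def)
  consider "r k < r l" | "r l < r k" | "k = l"
    using assms(1) k(1) l(1) by (metis inj_onD linorder_neqE_nat)
  then show ?thesis
  proof cases
    case 1
    then show ?thesis unfolding lex_pos_def using k l by (intro bexI[of _ k]) auto
  next
    case 2
    then show ?thesis unfolding lex_pos_def using k l by (intro bexI[of _ l]) auto
  next
    case 3
    then show ?thesis unfolding lex_pos_def using k l by (intro bexI[of _ k]) auto
  qed
qed

lemma lex_pos_total:
  assumes "inj_on r S" "x \<in> S" "f x \<noteq> 0"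
  shows "lex_pos r S f \<or> lex_pos r S (\<lambda>x. - f x)"
proof -
  obtain k where k: "k \<in> S \<and> f k \<noteq> 0" "\<forall>j. j \<in> S \<and> f j \<noteq> 0 \<longrightarrow> r k \<le> r j"
    using assms(2,3) ex_has_least_nat[of "\<lambda>k. k \<in> S \<and> f k \<noteq> 0" x r] by auto
  then have "\<forall>j\<in>S. r j < r k \<longrightarrow> f j = 0" by force
  then show ?thesis unfolding lex_pos_def using k(1)
    by (metis (no_types, lifting) linorder_neqE_linordered_idom neg_0_less_iff_less neg_equal_0_iff_equal)
qed

lemma lex_pos_asym:
  assumes "inj_on r S" "lex_pos r S (\<lambda>x. f x - g x)"
  shows "\<not> lex_pos r S (\<lambda>x. g x - f x)"
  using lex_pos_add[OF assms, of "\<lambda>x. g x - f x"] by (auto simp: lex_pos_def)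

text \<open>Coefficients are pinned to zero off \<open>S\<close>, so equality of representations is
  equality of functions, and one function can serve for several vertex sets.\<close>

definition barycentric :: "'a::real_vector set \<Rightarrow> 'a \<Rightarrow> ('a \<Rightarrow> real) \<Rightarrow> bool" where
  "barycentric S x u \<longleftrightarrow> (\<forall>s. 0 \<le> u s) \<and> (\<forall>s. s \<notin> S \<longrightarrow> u s = 0) \<and> sum u S = 1 \<and>
     (\<Sum>s\<in>S. u s *\<^sub>R s) = x"

abbreviation supp :: "('a \<Rightarrow> real) \<Rightarrow> 'a set" where
  "supp u \<equiv> {s. u s \<noteq> 0}"

lemma barycentric_mono:
  assumes "finite S" "T \<subseteq> S" "barycentric T x u"
  shows "barycentric S x u"
proof -
  have "sum u S = sum u T"
    using assms by (intro sum.mono_neutral_right) (auto simp: barycentric_def)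
  moreover have "(\<Sum>s\<in>S. u s *\<^sub>R s) = (\<Sum>s\<in>T. u s *\<^sub>R s)"
    using assms by (intro sum.mono_neutral_right) (auto simp: barycentric_def)
  ultimately show ?thesis using assms by (auto simp: barycentric_def)
qed

lemma barycentric_shrink:
  assumes "finite S" "T \<subseteq> S" "barycentric S x u" "supp u \<subseteq> T"
  shows "barycentric T x u"
proof -
  have "sum u S = sum u T"
    using assms by (intro sum.mono_neutral_right) auto
  moreover have "(\<Sum>s\<in>S. u s *\<^sub>R s) = (\<Sum>s\<in>T. u s *\<^sub>R s)"
    using assms by (intro sum.mono_neutral_right) auto
  ultimately show ?thesis using assms by (auto simp: barycentric_def)
qed

lemma supp_subset: "barycentric S x u \<Longrightarrow> supp u \<subseteq> S"
  by (auto simp: barycentric_def)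

lemma in_convex_hull_iff_barycentric:
  fixes S :: "'a::real_vector set"
  assumes "finite S"
  shows "x \<in> convex hull S \<longleftrightarrow> (\<exists>u. barycentric S x u)"
proof
  assume "x \<in> convex hull S"
  then obtain u where u: "\<forall>s\<in>S. 0 \<le> u s" "sum u S = 1" "(\<Sum>s\<in>S. u s *\<^sub>R s) = x"
    using assms by (auto simp: convex_hull_finite)
  have "(\<Sum>s\<in>S. (if s \<in> S then u s else 0) *\<^sub>R s) = (\<Sum>s\<in>S. u s *\<^sub>R s)"
    by (intro sum.cong) auto
  then have "barycentric S x (\<lambda>s. if s \<in> S then u s else 0)"
    using u by (auto simp: barycentric_def)
  then show "\<exists>u. barycentric S x u" by blast
next
  assume "\<exists>u. barycentric S x u"
  then show "x \<in> convex hull S"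
    using assms by (auto simp: convex_hull_finite barycentric_def)
qed

text \<open>The difference of two distinct representations would be an affine dependency of
  \<open>S\<close>.\<close>

lemma barycentric_unique:
  fixes S :: "'a::euclidean_space set"
  assumes "finite S" "\<not> affine_dependent S" "barycentric S x u" "barycentric S x v"
  shows "u = v"
proof (rule ccontr)
  assume "u \<noteq> v"
  then obtain s where "u s \<noteq> v s" by auto
  then have "s \<in> S" "u s - v s \<noteq> 0" using assms(3,4) unfolding barycentric_def by force+
  moreover have "(\<Sum>s\<in>S. u s - v s) = 0" "(\<Sum>s\<in>S. (u s - v s) *\<^sub>R s) = 0"
    using assms(3,4) by (auto simp: barycentric_def sum_subtractf scaleR_diff_left)
  ultimately show False
    using assms(1,2) affine_dependent_explicit_finite[of S] by blast
qed

text \<open>Moving a representation along an affine dependency of its support, against the lexicographic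
  order, until a coefficient vanishes.\<close>

lemma barycentric_improve:
  fixes S :: "'a::euclidean_space set"
  assumes S: "finite S" "inj_on r S" and u: "barycentric S x u" and dep: "affine_dependent (supp u)"
  shows "\<exists>v. barycentric S x v \<and> card (supp v) < card (supp u) \<and> lex_pos r S (\<lambda>s. u s - v s)"
proof -
  have sub: "supp u \<subseteq> S" and fin: "finite (supp u)"
    using supp_subset[OF u] S(1) finite_subset by auto
  obtain w0 where w0: "sum w0 (supp u) = 0" "\<exists>s\<in>supp u. w0 s \<noteq> 0" "(\<Sum>s\<in>supp u. w0 s *\<^sub>R s) = 0"
    using dep affine_dependent_explicit_finite[OF fin] by blast
  define w1 where "w1 s = (if s \<in> supp u then w0 s else 0)" for s
  have w1: "sum w1 S = 0" "(\<Sum>s\<in>S. w1 s *\<^sub>R s) = 0" "\<And>s. w1 s \<noteq> 0 \<Longrightarrow> u s \<noteq> 0"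
  proof -
    have "sum w1 S = sum w0 (supp u)"
      using S(1) sub by (intro sum.mono_neutral_cong_right) (auto simp: w1_def)
    then show "sum w1 S = 0" using w0 by simp
    have "(\<Sum>s\<in>S. w1 s *\<^sub>R s) = (\<Sum>s\<in>supp u. w0 s *\<^sub>R s)"
      using S(1) sub by (intro sum.mono_neutral_cong_right) (auto simp: w1_def)
    then show "(\<Sum>s\<in>S. w1 s *\<^sub>R s) = 0" using w0 by simp
  qed (auto simp: w1_def split: if_splits)
  obtain s0 where "s0 \<in> S" "w1 s0 \<noteq> 0" using w0(2) sub by (auto simp: w1_def)
  \<comment> \<open>A dependency may be negated, so its sign can be chosen to make subtracting it a
    descent in the order.\<close>
  then have "lex_pos r S w1 \<or> lex_pos r S (\<lambda>s. - w1 s)" using lex_pos_total S(2) by metis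
  then obtain w where w: "sum w S = 0" "(\<Sum>s\<in>S. w s *\<^sub>R s) = 0" "\<And>s. w s \<noteq> 0 \<Longrightarrow> u s \<noteq> 0"
      and lex: "lex_pos r S w"
  proof
    assume "lex_pos r S w1"
    then show ?thesis using that[of w1] w1 by auto
  next
    assume "lex_pos r S (\<lambda>s. - w1 s)"
    then show ?thesis using that[of "\<lambda>s. - w1 s"] w1 by (auto simp: sum_negf)
  qed
  define Q where "Q = {s\<in>S. w s > 0}"
  \<comment> \<open>Ratio test: \<open>t\<close> is the longest step for which
    \<open>u - t * w\<close> stays nonnegative. At an index \<open>q\<close> attaining the minimum
    the coefficient becomes zero, so the support shrinks.\<close>
  define t where "t = Min ((\<lambda>s. u s / w s) ` Q)"
  have Q: "finite Q" "Q \<noteq> {}" using S(1) lex by (auto simp: Q_def lex_pos_def)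
  have nonneg: "u s \<ge> 0" for s using u by (simp add: barycentric_def)
  have "t \<in> (\<lambda>s. u s / w s) ` Q" unfolding t_def using Q by (intro Min_in) auto
  then obtain q where q: "q \<in> Q" "t = u q / w q" by auto
  have "u q > 0" using q(1) w(3)[of q] nonneg[of q] by (auto simp: Q_def)
  then have t: "t > 0" using q by (simp add: Q_def)
  define v where "v s = u s - t * w s" for s
  have "0 \<le> v s" for s
  proof (cases "w s > 0")
    case True
    then have "s \<in> Q" using w(3)[of s] sub by (auto simp: Q_def)
    then have "t \<le> u s / w s" unfolding t_def using Q by (intro Min_le) auto
    then show ?thesis using True by (simp add: v_def field_simps)
  next
    case False
    then have "t * w s \<le> 0" using t by (simp add: mult_le_0_iff)
    then show ?thesis using nonneg[of s] by (simp add: v_def)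
  qed
  moreover have "sum v S = 1"
    using u w by (simp add: v_def sum_subtractf barycentric_def flip: sum_distrib_left)
  moreover have "(\<Sum>s\<in>S. v s *\<^sub>R s) = x"
    using u w by (simp add: v_def sum_subtractf barycentric_def scaleR_diff_left
        flip: scaleR_scaleR scaleR_sum_right)
  moreover have supp: "supp v \<subseteq> supp u" using w(3) by (auto simp: v_def)
  ultimately have "barycentric S x v" using sub by (auto simp: barycentric_def)
  moreover have "card (supp v) < card (supp u)"
  proof (rule psubset_card_mono[OF fin])
    have "v q = 0" using q \<open>u q > 0\<close> by (auto simp: v_def Q_def)
    then show "supp v \<subset> supp u" using supp \<open>u q > 0\<close> by auto
  qed
  moreover have "lex_pos r S (\<lambda>s. u s - v s)" using lex t by (simp add: v_def lex_pos_scale)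
  ultimately show ?thesis by blast
qed

text \<open>Strict comparison with every competitor, rather than mere minimality, makes the
  representation unique as soon as \<open>r\<close> is injective on \<open>S\<close>.\<close>

definition lex_least :: "('a::real_vector \<Rightarrow> nat) \<Rightarrow> 'a set \<Rightarrow> 'a \<Rightarrow> ('a \<Rightarrow> real) \<Rightarrow> bool" where
  "lex_least r S x u \<longleftrightarrow> barycentric S x u \<and>
     (\<forall>v. barycentric S x v \<longrightarrow> v \<noteq> u \<longrightarrow> lex_pos r S (\<lambda>s. v s - u s))"

text \<open>Otherwise \<open>barycentric_improve\<close> would produce a strictly smaller
  representation.\<close>

lemma lex_least_affine_independent:
  fixes S :: "'a::euclidean_space set"
  assumes "finite S" "inj_on r S" "lex_least r S x u"
  shows "\<not> affine_dependent (supp u)"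
proof
  assume "affine_dependent (supp u)"
  then obtain v where v: "barycentric S x v" "card (supp v) < card (supp u)"
      "lex_pos r S (\<lambda>s. u s - v s)"
    using barycentric_improve[OF assms(1,2)] assms(3) unfolding lex_least_def by blast
  then have "v \<noteq> u" by auto
  then have "lex_pos r S (\<lambda>s. v s - u s)" using v(1) assms(3) by (auto simp: lex_least_def)
  then show False using lex_pos_asym[OF assms(2)] v(3) by blast
qed

text \<open>There may be infinitely many representations, so a minimum is not immediate. But each is
  equal to or above one with affinely independent support, and there are only finitely many of
  those.\<close>

lemma lex_least_exists:
  fixes S :: "'a::euclidean_space set"
  assumes S: "finite S" "inj_on r S" and x: "x \<in> convex hull S"
  shows "\<exists>u. lex_least r S x u"
proof -
  define B where "B = {u. barycentric S x u \<and> \<not> affine_dependent (supp u)}"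
  define R where "R = (\<lambda>u v. lex_pos r S (\<lambda>s. v s - u s))"
  \<comment> \<open>Repeated improvement terminates because each round shrinks the support;
    transitivity composes the rounds.\<close>
  have below: "\<exists>v\<in>B. v = u \<or> R v u" if "barycentric S x u" for u
    using that
  proof (induction "card (supp u)" arbitrary: u rule: less_induct)
    case less
    show ?case
    proof (cases "affine_dependent (supp u)")
      case True
      then obtain v where v: "barycentric S x v" "card (supp v) < card (supp u)" "R v u"
        using barycentric_improve[OF S less.prems] by (auto simp: R_def)
      then obtain v' where v': "v' \<in> B" "v' = v \<or> R v' v" using less.hyps by blast
      have "R v' u" if "R v' v"
        using lex_pos_add[OF S(2) that[unfolded R_def] v(3)[unfolded R_def]] by (simp add: R_def)
      then show ?thesis using v v' by blast
    next
      case False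
      then show ?thesis using less.prems by (auto simp: B_def)
    qed
  qed
  \<comment> \<open>An independent support determines its coefficients, so \<open>B\<close> embeds
    into the finite power set of \<open>S\<close>.\<close>
  have "inj_on supp B"
  proof (rule inj_onI)
    fix u v assume uv: "u \<in> B" "v \<in> B" and eq: "supp u = supp v"
    have "supp u \<subseteq> S" using uv supp_subset by (auto simp: B_def)
    then have "barycentric (supp u) x u" "barycentric (supp u) x v"
      using uv eq barycentric_shrink[OF S(1)] by (auto simp: B_def)
    then show "u = v"
      using barycentric_unique[of "supp u"] uv(1) finite_subset[OF \<open>supp u \<subseteq> S\<close> S(1)]
      by (auto simp: B_def)
  qed
  moreover have "supp ` B \<subseteq> Pow S" using supp_subset by (auto simp: B_def)
  ultimately have "finite B" using S(1) by (meson finite_Pow_iff finite_imageD finite_subset)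
  moreover have "asymp_on B R"
    by (rule asymp_onI) (use lex_pos_asym[OF S(2)] in \<open>auto simp: R_def\<close>)
  moreover have trans: "R u w" if "R u v" "R v w" for u v w
    using lex_pos_add[OF S(2) that[unfolded R_def]] by (simp add: R_def)
  then have "transp_on B R" by (auto intro: transp_onI)
  moreover have "B \<noteq> {}" using below x in_convex_hull_iff_barycentric[OF S(1)] by blast
  ultimately obtain m where m: "m \<in> B" "\<forall>u\<in>B. u \<noteq> m \<longrightarrow> \<not> R u m"
    using Finite_Set.bex_min_element[of B R] by blast
  \<comment> \<open>Totality turns the minimal element \<open>m\<close> into a least one.\<close>
  have le: "R m u" if u: "barycentric S x u" "u \<noteq> m" "\<not> R u m" for u
  proof -
    obtain s where "u s \<noteq> m s" using u(2) by auto
    then have "s \<in> S" "u s - m s \<noteq> 0" using u(1) m(1) unfolding B_def barycentric_def by force+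
    then show ?thesis using lex_pos_total[OF S(2), of s "\<lambda>s. u s - m s"] u(3) by (auto simp: R_def)
  qed
  have "R m u" if u: "barycentric S x u" "u \<noteq> m" for u
  proof -
    obtain v where v: "v \<in> B" "v = u \<or> R v u" using below[OF u(1)] by blast
    have "v = m \<or> R m v" using le[of v] m v(1) by (auto simp: B_def)
    then show ?thesis using v(2) u(2) trans by blast
  qed
  then have "lex_least r S x m" using m(1) by (auto simp: lex_least_def B_def R_def)
  then show ?thesis by blast
qed

text \<open>A competitor \<open>v\<close> of \<open>a\<close> yields the competitor \<open>u + e (v - a)\<close> of \<open>u\<close>, which is nonnegative for small
  \<open>e > 0\<close> because \<open>u\<close> is positive wherever \<open>v - a\<close> can be negative.\<close>

lemma lex_least_face:
  fixes S :: "'a::euclidean_space set"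
  assumes S: "finite S" "inj_on r S" and u: "lex_least r S x u"
    and a: "barycentric S y a" "supp a \<subseteq> supp u"
  shows "lex_least r S y a"
  unfolding lex_least_def
proof (intro conjI allI impI)
  fix v assume v: "barycentric S y v" "v \<noteq> a"
  have bu: "barycentric S x u" using u by (simp add: lex_least_def)
  have fin: "finite (supp u)" using supp_subset[OF bu] S(1) finite_subset by blast
  have ne: "supp u \<noteq> {}"
  proof
    assume "supp u = {}"
    then have "sum u S = 0" by (intro sum.neutral) auto
    then show False using bu by (simp add: barycentric_def)
  qed
  \<comment> \<open>The smallest positive coefficient of \<open>u\<close> is a safe step: since
    \<open>a \<le> 1\<close> and \<open>v \<ge> 0\<close>, the perturbation
    \<open>e * (v - a)\<close> is at least \<open>- e\<close>, which \<open>u\<close> absorbs on its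
    support.\<close>
  define e where "e = Min (u ` supp u)"
  have pos: "u s > 0" if "u s \<noteq> 0" for s
    using that bu by (auto simp: barycentric_def order.strict_iff_order)
  have e: "e > 0" unfolding e_def using fin ne pos by (subst Min_gr_iff) auto
  have e_le: "e \<le> u s" if "u s \<noteq> 0" for s
    unfolding e_def using fin that by (intro Min_le) auto
  have le1: "a s \<le> 1" for s
  proof (cases "s \<in> S")
    case True
    then have "a s \<le> sum a S" using a(1) S(1) by (intro member_le_sum) (auto simp: barycentric_def)
    then show ?thesis using a(1) by (simp add: barycentric_def)
  qed (use a(1) in \<open>auto simp: barycentric_def\<close>)
  define w where "w s = u s + e * (v s - a s)" for s
  have "w s \<ge> 0" for s
  proof (cases "u s = 0")
    case True
    then have "a s = 0" using a(2) by auto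
    then show ?thesis using True e v(1) by (simp add: w_def barycentric_def)
  next
    case False
    have "v s - a s \<ge> -1" using le1[of s] v(1) by (smt (verit) barycentric_def)
    then have "e * (v s - a s) \<ge> e * (-1)" using e by (intro mult_left_mono) auto
    then show ?thesis using e_le[OF False] by (simp add: w_def)
  qed
  moreover have "sum w S = 1"
    using bu a(1) v(1) by (simp add: w_def sum.distrib sum_subtractf barycentric_def flip: sum_distrib_left)
  moreover have "(\<Sum>s\<in>S. w s *\<^sub>R s) = x"
    using bu a(1) v(1) by (simp add: w_def sum.distrib sum_subtractf barycentric_def scaleR_add_left
        scaleR_diff_left flip: scaleR_scaleR scaleR_sum_right)
  ultimately have "barycentric S x w" using bu a(1) v(1) by (auto simp: barycentric_def w_def)
  moreover have "w \<noteq> u"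
  proof -
    obtain s where "v s \<noteq> a s" using v(2) by auto
    then have "w s \<noteq> u s" using e by (simp add: w_def)
    then show ?thesis by auto
  qed
  ultimately have "lex_pos r S (\<lambda>s. w s - u s)" using u by (simp add: lex_least_def)
  then show "lex_pos r S (\<lambda>s. v s - a s)" using e by (simp add: w_def lex_pos_scale)
qed (use a in auto)

text \<open>The cells are spanned by the supports of lexicographically least representations. They
  cover because least representations exist. They meet properly because a common point of two cells
  has a representation on each vertex set, both are least by \<open>lex_least_face\<close>, hence
  equal and supported on the intersection.\<close>

lemma convex_hull_triangulation:
  fixes S :: "'a::euclidean_space set"
  assumes S: "finite S"
  obtains \<G> where "\<And>T. T \<in> \<G> \<Longrightarrow> T \<subseteq> S" "\<And>T. T \<in> \<G> \<Longrightarrow> \<not> affine_dependent T"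
    "convex hull S = (\<Union>T\<in>\<G>. convex hull T)"
    "\<And>T T'. T \<in> \<G> \<Longrightarrow> T' \<in> \<G> \<Longrightarrow> convex hull T \<inter> convex hull T' \<subseteq> convex hull (T \<inter> T')"
proof -
  obtain r :: "'a \<Rightarrow> nat" where r: "inj_on r S"
    using S by (metis countable_def countable_finite)
  define \<G> where "\<G> = {supp u | u. \<exists>x. lex_least r S x u}"
  have sub: "T \<subseteq> S" if "T \<in> \<G>" for T
    using that supp_subset by (fastforce simp: \<G>_def lex_least_def)
  show ?thesis
  proof
    show "T \<subseteq> S" if "T \<in> \<G>" for T using sub that .
    show "\<not> affine_dependent T" if "T \<in> \<G>" for T
      using that lex_least_affine_independent[OF S r] by (auto simp: \<G>_def)
    show "convex hull S = (\<Union>T\<in>\<G>. convex hull T)"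
    proof
      show "(\<Union>T\<in>\<G>. convex hull T) \<subseteq> convex hull S"
        using sub hull_mono by blast
      show "convex hull S \<subseteq> (\<Union>T\<in>\<G>. convex hull T)"
      proof
        fix x assume "x \<in> convex hull S"
        then obtain u where u: "lex_least r S x u" using lex_least_exists[OF S r] by blast
        then have "barycentric S x u" by (simp add: lex_least_def)
        then have "barycentric (supp u) x u" "supp u \<subseteq> S"
          using barycentric_shrink[OF S supp_subset] supp_subset by blast+
        then have "x \<in> convex hull (supp u)"
          using in_convex_hull_iff_barycentric S finite_subset by metis
        then show "x \<in> (\<Union>T\<in>\<G>. convex hull T)" using u by (auto simp: \<G>_def)
      qed
    qed
    show "convex hull T \<inter> convex hull T' \<subseteq> convex hull (T \<inter> T')" if "T \<in> \<G>" "T' \<in> \<G>" for T T'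
    proof
      fix x assume x: "x \<in> convex hull T \<inter> convex hull T'"
      have fin: "finite T" "finite T'" using sub that S finite_subset by blast+
      obtain a b where ab: "barycentric T x a" "barycentric T' x b"
        using x in_convex_hull_iff_barycentric fin by blast
      \<comment> \<open>\<open>T\<close> is itself the support of a least representation, possibly
        of another point, and \<open>a\<close> lives on it.\<close>
      have "lex_least r S x a"
        using that(1) lex_least_face[OF S r _ barycentric_mono[OF S sub[OF that(1)] ab(1)]]
          supp_subset[OF ab(1)] by (force simp: \<G>_def)
      moreover have "lex_least r S x b"
        using that(2) lex_least_face[OF S r _ barycentric_mono[OF S sub[OF that(2)] ab(2)]]
          supp_subset[OF ab(2)] by (force simp: \<G>_def)
      ultimately have "a = b"
        unfolding lex_least_def using lex_pos_asym[OF r] by blast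
      then have "supp a \<subseteq> T \<inter> T'" using ab supp_subset by auto
      then have "barycentric (T \<inter> T') x a"
        using barycentric_shrink[OF fin(1) _ ab(1)] by auto
      then show "x \<in> convex hull (T \<inter> T')"
        using in_convex_hull_iff_barycentric[of "T \<inter> T'"] fin by blast
    qed
  qed
qed

section \<open>The standard simplex\<close>

lemma integral_exp_imaginary_Icc:
  fixes a t :: real
  assumes "a \<noteq> 0" "t \<ge> 0"
  shows "(LINT y|lborel. indicator {0..t} y *\<^sub>R exp (\<i> * of_real (a * y))) =
           (exp (\<i> * of_real (a * t)) - 1) / (\<i> * of_real a)"
proof -
  have "(LINT y|lborel. indicator {0..t} y *\<^sub>R exp (\<i> * of_real (a * y))) =
      exp (\<i> * of_real (a * t)) / (\<i> * of_real a) - exp (\<i> * of_real (a * 0)) / (\<i> * of_real a)"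
  proof (rule integral_FTC_Icc[OF assms(2)])
    fix x
    have "((\<lambda>z. exp (\<i> * of_real a * z)) has_field_derivative
        exp (\<i> * of_real a * of_real x) * (\<i> * of_real a)) (at (of_real x))"
      by (rule derivative_eq_intros refl | simp)+
    from DERIV_cdivide[OF this, of "\<i> * of_real a"]
    have "((\<lambda>z. exp (\<i> * of_real a * z) / (\<i> * of_real a)) has_field_derivative
        exp (\<i> * of_real a * of_real x)) (at (of_real x))"
      using assms(1) by simp
    from has_vector_derivative_real_field[OF this, of "{0..t}"]
    show "((\<lambda>y. exp (\<i> * of_real (a * y)) / (\<i> * of_real a)) has_vector_derivative
        exp (\<i> * of_real (a * x))) (at x within {0..t})" by (simp add: mult.assoc)
  qed (auto intro!: continuous_intros)
  then show ?thesis by (simp add: diff_divide_distrib)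
qed

text \<open>Induction on the dimension: integrating out coordinate \<open>k\<close> leaves the
  difference of two integrals over the smaller simplex, with frequencies \<open>b j - b k\<close>
  and \<open>b j\<close>. Both families inherit the hypotheses, distinctness giving
  \<open>b j - b k \<noteq> 0\<close>. This is the recursion for divided differences.\<close>

lemma integral_std_simplex_PiM_eq_0:
  fixes b :: "'a \<Rightarrow> real"
  assumes "finite I" "I \<noteq> {}" "inj_on b I" "\<And>j. j \<in> I \<Longrightarrow> b j \<noteq> 0"
    "\<And>j. j \<in> I \<Longrightarrow> exp (\<i> * of_real (b j)) = 1"
  shows "(LINT x|Pi\<^sub>M I (\<lambda>_. lborel). indicator {x. (\<forall>i\<in>I. 0 \<le> x i) \<and> sum x I \<le> 1} x *\<^sub>R
      exp (\<i> * of_real (\<Sum>j\<in>I. b j * x j))) = 0"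
  using assms
proof (induction I arbitrary: b rule: finite_induct)
  case empty
  then show ?case by simp
next
  case (insert k I)
  interpret product_sigma_finite "\<lambda>_. lborel" by standard
  define S :: "'a set \<Rightarrow> ('a \<Rightarrow> real) set" where "S I = {x. (\<forall>i\<in>I. 0 \<le> x i) \<and> sum x I \<le> 1}" for I
  define J where "J I b = (LINT x|Pi\<^sub>M I (\<lambda>_. lborel). indicator (S I) x *\<^sub>R
      exp (\<i> * of_real (\<Sum>j\<in>I. b j * x j)))" for I and b :: "'a \<Rightarrow> real"
  have integrable: "integrable (Pi\<^sub>M I (\<lambda>_. lborel)) (\<lambda>x. indicator (S I) x *\<^sub>R
      exp (\<i> * of_real (\<Sum>j\<in>I. b j * x j)))" if "finite I" for I and b :: "'a \<Rightarrow> real"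
  proof -
    let ?M = "Pi\<^sub>M I (\<lambda>_. lborel)"
    have eq: "S I \<inter> space ?M = Pi\<^sub>E I (\<lambda>_. {0..}) \<inter> (\<lambda>x. sum x I) -` {..1} \<inter> space ?M"
      by (auto simp: S_def space_PiM)
    have meas: "S I \<inter> space ?M \<in> sets ?M"
      unfolding eq using that by measurable
    have "emeasure ?M (S I \<inter> space ?M) < \<infinity>"
      using emeasure_std_simplex_aux[OF that, of 1] unfolding S_def
      by (simp add: ennreal_divide_eq_top_iff less_top ennreal_fact[symmetric] divide_ennreal flip: ennreal_1)
    moreover have "(\<lambda>x. exp (\<i> * of_real (\<Sum>j\<in>I. b j * x j))) \<in> borel_measurable ?M"
      using that by measurable
    ultimately have "integrable ?M (\<lambda>x. indicator (S I \<inter> space ?M) x *\<^sub>R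
      exp (\<i> * of_real (\<Sum>j\<in>I. b j * x j)))"
      using meas by (intro integrableI_bounded_set_indicator[where B=1]) auto
    then show ?thesis
      by (rule Bochner_Integration.integrable_cong[THEN iffD1, rotated 2]) (auto simp: indicator_def)
  qed
  have k: "b k \<noteq> 0" "exp (\<i> * of_real (b k)) = 1" using insert.prems by auto
  have step: "J (insert k I) b = (J I (\<lambda>j. b j - b k) - J I b) / (\<i> * of_real (b k))"
  proof -
    have inner: "(LINT y|lborel. indicator (S (insert k I)) (x(k := y)) *\<^sub>R
          exp (\<i> * of_real (\<Sum>j\<in>insert k I. b j * (x(k := y)) j))) =
        (indicator (S I) x *\<^sub>R exp (\<i> * of_real (\<Sum>j\<in>I. (b j - b k) * x j)) -
         indicator (S I) x *\<^sub>R exp (\<i> * of_real (\<Sum>j\<in>I. b j * x j))) / (\<i> * of_real (b k))"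
      (is "?l = ?r") for x
    proof -
      have upd: "(\<Sum>j\<in>I. f j ((x(k := y)) j)) = (\<Sum>j\<in>I. f j (x j))"
        for y and f :: "'a \<Rightarrow> real \<Rightarrow> real"
        using insert.hyps by (intro sum.cong) auto
      \<comment> \<open>The slice over \<open>x\<close> is an interval, and
        \<open>x \<in> S I\<close> guarantees that its upper end is nonnegative.\<close>
      have S_iff: "x(k := y) \<in> S (insert k I) \<longleftrightarrow> x \<in> S I \<and> y \<in> {0..1 - sum x I}" for y
        using insert.hyps upd[where f = "\<lambda>_ y. y"] sum_nonneg[of I x] by (force simp: S_def)
      have "?l = (LINT y|lborel. (indicator (S I) x *\<^sub>R exp (\<i> * of_real (\<Sum>j\<in>I. b j * x j))) *
          (indicator {0..1 - sum x I} y *\<^sub>R exp (\<i> * of_real (b k * y))))"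
        using insert.hyps upd[where f = "\<lambda>j y. b j * y"]
        by (intro Bochner_Integration.integral_cong)
          (auto simp: indicator_def S_iff distrib_left exp_add)
      also have "\<dots> = (indicator (S I) x *\<^sub>R exp (\<i> * of_real (\<Sum>j\<in>I. b j * x j))) *
          (LINT y|lborel. indicator {0..1 - sum x I} y *\<^sub>R exp (\<i> * of_real (b k * y)))"
        by (rule integral_mult_right_zero)
      also have "\<dots> = ?r"
      proof (cases "x \<in> S I")
        case True
        \<comment> \<open>The upper endpoint shifts every frequency by \<open>- b k\<close> and
          leaves the constant factor \<open>exp (\<i> * b k)\<close>, which is
          \<open>1\<close>.\<close>
        have "exp (\<i> * of_real (\<Sum>j\<in>I. b j * x j)) * exp (\<i> * of_real (b k * (1 - sum x I))) =
            exp (\<i> * of_real (b k)) * exp (\<i> * of_real (\<Sum>j\<in>I. (b j - b k) * x j))"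
          by (simp add: sum_distrib_left sum_subtractf algebra_simps flip: exp_add)
        then have "exp (\<i> * of_real (\<Sum>j\<in>I. b j * x j)) * (exp (\<i> * of_real (b k * (1 - sum x I))) - 1) =
           exp (\<i> * of_real (\<Sum>j\<in>I. (b j - b k) * x j)) - exp (\<i> * of_real (\<Sum>j\<in>I. b j * x j))"
          using k(2) by (simp add: algebra_simps)
        then show ?thesis
          using True k(1) integral_exp_imaginary_Icc[of "b k" "1 - sum x I"]
          by (simp add: S_def)
      qed simp
      finally show ?thesis .
    qed
    have "J (insert k I) b = (LINT x|Pi\<^sub>M I (\<lambda>_. lborel).
        (indicator (S I) x *\<^sub>R exp (\<i> * of_real (\<Sum>j\<in>I. (b j - b k) * x j)) -
         indicator (S I) x *\<^sub>R exp (\<i> * of_real (\<Sum>j\<in>I. b j * x j))) / (\<i> * of_real (b k)))"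
      unfolding J_def inner[symmetric]
      by (rule product_integral_insert) (use insert.hyps integrable[of "insert k I"] in \<open>simp_all del: sum.insert\<close>)
    also have "\<dots> = (J I (\<lambda>j. b j - b k) - J I b) / (\<i> * of_real (b k))"
      unfolding J_def integral_divide_zero
      by (subst Bochner_Integration.integral_diff[OF integrable integrable]) (use insert.hyps in auto)
    finally show ?thesis .
  qed
  \<comment> \<open>For nonempty \<open>I\<close> both sides vanish by induction. For empty
    \<open>I\<close> they are nonzero but identical, as no frequency enters; this starts the
    induction at dimension one.\<close>
  have "J I (\<lambda>j. b j - b k) = J I b"
  proof (cases "I = {}")
    case False
    have exp_j: "exp (\<i> * of_real (b j)) = 1" if "j \<in> I" for j using that insert.prems by auto
    have "J I b = 0"
      unfolding J_def S_def using insert.prems False by (intro insert.IH) auto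
    moreover have "J I (\<lambda>j. b j - b k) = 0"
      unfolding J_def S_def using insert.prems insert.hyps False exp_j k(2)
      by (intro insert.IH) (auto simp: inj_on_def right_diff_distrib exp_diff)
    ultimately show ?thesis by simp
  qed (simp add: J_def)
  then show ?case using step by (simp add: J_def S_def)
qed

lemma integral_std_simplex_eq_0:
  fixes c :: "'a::euclidean_space"
  assumes "inj_on (\<lambda>b. c \<bullet> b) Basis" "\<And>b. b \<in> Basis \<Longrightarrow> c \<bullet> b \<noteq> 0"
    "\<And>b. b \<in> Basis \<Longrightarrow> exp (\<i> * of_real (c \<bullet> b)) = 1"
  shows "(LINT x:convex hull (insert 0 Basis)|lborel. exp (\<i> * of_real (c \<bullet> x))) = 0"
proof -
  let ?S = "convex hull (insert 0 Basis) :: 'a set"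
  let ?M = "Pi\<^sub>M (Basis :: 'a set) (\<lambda>_. lborel :: real measure)"
  let ?g = "\<lambda>f. \<Sum>b\<in>Basis. f b *\<^sub>R b :: 'a"
  have "compact ?S" by (intro finite_imp_compact_convex_hull) auto
  then have [measurable]: "?S \<in> sets borel" by (simp add: borel_compact)
  have mem: "?g f \<in> ?S \<longleftrightarrow> (\<forall>i\<in>Basis. 0 \<le> f i) \<and> sum f Basis \<le> 1" for f
    by (simp add: std_simplex)
  have "(LINT x:?S|lborel. exp (\<i> * of_real (c \<bullet> x))) =
      (LINT f|?M. indicator ?S (?g f) *\<^sub>R exp (\<i> * of_real (c \<bullet> ?g f)))"
    unfolding set_lebesgue_integral_def by (subst lborel_eq, subst integral_distr) auto
  also have "\<dots> = (LINT f|?M. indicator {x. (\<forall>i\<in>Basis. 0 \<le> x i) \<and> sum x Basis \<le> 1} f *\<^sub>R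
      exp (\<i> * of_real (\<Sum>b\<in>Basis. (c \<bullet> b) * f b)))"
    by (intro Bochner_Integration.integral_cong)
      (auto simp: indicator_def mem inner_sum_right mult.commute)
  also have "\<dots> = 0"
    using assms by (intro integral_std_simplex_PiM_eq_0) auto
  finally show ?thesis .
qed

section \<open>Linear images of Lebesgue measure\<close>

lemma nn_integral_lborel_translate:
  fixes c :: "'a::euclidean_space"
  assumes [measurable]: "f \<in> borel_measurable borel"
  shows "(\<integral>\<^sup>+x. f (c + x) \<partial>lborel) = (\<integral>\<^sup>+x. f x \<partial>lborel)"
  by (subst (2) lborel_distr_plus[of c, symmetric], subst nn_integral_distr) auto

text \<open>Fubini proof of the uniqueness of translation invariant measures; it avoids the well-ordered
  index type that \<open>integral_change_of_variables_linear\<close> asks for.\<close>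

lemma lborel_distr_linear:
  fixes L :: "'a::euclidean_space \<Rightarrow> 'a"
  assumes "linear L" "inj L"
  obtains c :: real where "c > 0" "distr lborel borel L = density lborel (\<lambda>_. ennreal c)"
proof -
  interpret linear L by fact
  have "continuous_on UNIV L" using assms(1) by (simp add: linear_continuous_on linear_linear)
  then have [measurable]: "L \<in> borel_measurable borel" by (rule borel_measurable_continuous_onI)
  obtain K where K: "linear K" "\<And>x. K (L x) = x" "\<And>x. L (K x) = x"
    using linear_injective_isomorphism[OF assms] by auto
  define B where "B = ball (0::'a) 1"
  have [measurable]: "B \<in> sets borel" by (simp add: B_def)
  define m where "m A = emeasure lborel (L -` A)" for A
  have m_eq: "(\<integral>\<^sup>+x. indicator A (L x) \<partial>lborel) = m A" if [measurable]: "A \<in> sets borel" for A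
  proof -
    have "L -` A \<in> sets borel" by (rule measurable_sets_borel) measurable
    moreover have "(\<lambda>x. indicator A (L x)) = (indicator (L -` A) :: 'a \<Rightarrow> ennreal)"
      by (auto simp: indicator_def)
    ultimately show ?thesis by (simp add: m_def)
  qed
  \<comment> \<open>Both sides evaluate the double integral of
    \<open>indicator A (L x) * indicator B (y - L x)\<close>. Integrating over \<open>y\<close>
    first gives the left side; shifting \<open>x\<close> by \<open>K y\<close>, using
    \<open>B = - B\<close>, and then swapping the order gives the right side.\<close>
  have key: "m A * emeasure lborel B = emeasure lborel A * m B"
    if [measurable]: "A \<in> sets borel" for A
  proof -
    have iB: "indicator B (a - b) = (indicator B (b - a) :: ennreal)" for a b :: 'a
      by (simp add: B_def indicator_def norm_minus_commute)
    have "m A * emeasure lborel B = (\<integral>\<^sup>+x. indicator A (L x) * emeasure lborel B \<partial>lborel)"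
      by (subst nn_integral_multc) (simp_all add: m_eq)
    also have "\<dots> = (\<integral>\<^sup>+x. \<integral>\<^sup>+y. indicator A (L x) * indicator B (y - L x) \<partial>lborel \<partial>lborel)"
    proof (rule nn_integral_cong)
      fix x
      have "(\<integral>\<^sup>+y. indicator B (y - L x) \<partial>lborel) = (\<integral>\<^sup>+y. indicator B y \<partial>lborel)"
        using nn_integral_lborel_translate[of "indicator B" "- L x"] by simp
      then show "indicator A (L x) * emeasure lborel B =
          (\<integral>\<^sup>+y. indicator A (L x) * indicator B (y - L x) \<partial>lborel)"
        by (subst nn_integral_cmult) auto
    qed
    also have "\<dots> = (\<integral>\<^sup>+y. \<integral>\<^sup>+x. indicator A (L x) * indicator B (y - L x) \<partial>lborel \<partial>lborel)"
      by (rule lborel_pair.Fubini') measurable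
    also have "\<dots> = (\<integral>\<^sup>+y. \<integral>\<^sup>+x. indicator A (L x + y) * indicator B (L x) \<partial>lborel \<partial>lborel)"
    proof (rule nn_integral_cong)
      fix y
      have "(\<integral>\<^sup>+x. indicator A (L x) * indicator B (y - L x) \<partial>lborel) =
          (\<integral>\<^sup>+x. indicator A (L (K y + x)) * indicator B (y - L (K y + x)) \<partial>lborel)"
        by (rule nn_integral_lborel_translate[symmetric]) measurable
      also have "\<dots> = (\<integral>\<^sup>+x. indicator A (L x + y) * indicator B (L x) \<partial>lborel)"
        using iB[of 0] by (simp add: add K add.commute)
      finally show "(\<integral>\<^sup>+x. indicator A (L x) * indicator B (y - L x) \<partial>lborel) =
          (\<integral>\<^sup>+x. indicator A (L x + y) * indicator B (L x) \<partial>lborel)" .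
    qed
    also have "\<dots> = (\<integral>\<^sup>+x. \<integral>\<^sup>+y. indicator A (L x + y) * indicator B (L x) \<partial>lborel \<partial>lborel)"
      by (rule lborel_pair.Fubini') measurable
    also have "\<dots> = (\<integral>\<^sup>+x. emeasure lborel A * indicator B (L x) \<partial>lborel)"
    proof (rule nn_integral_cong)
      fix x
      have "(\<integral>\<^sup>+y. indicator A (L x + y) \<partial>lborel) = (\<integral>\<^sup>+y. indicator A y \<partial>lborel)"
        by (rule nn_integral_lborel_translate) measurable
      then show "(\<integral>\<^sup>+y. indicator A (L x + y) * indicator B (L x) \<partial>lborel) =
          emeasure lborel A * indicator B (L x)"
        by (subst nn_integral_multc) auto
    qed
    also have "\<dots> = emeasure lborel A * m B"
      by (subst nn_integral_cmult) (simp_all add: m_eq)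
    finally show ?thesis .
  qed
  have finite_pos: "0 < emeasure lborel U \<and> emeasure lborel U < \<infinity>"
    if "open U" "bounded U" "0 \<in> U" for U :: "'a set"
    using that emeasure_bounded_finite[of U] open_not_negligible[of U]
    by (auto simp: negligible_iff_null_sets null_sets_def zero_less_iff_neq_zero)
  have "open (L -` B)" unfolding B_def
    using \<open>continuous_on UNIV L\<close> by (simp add: open_vimage)
  moreover have "L -` B = K ` B" using K(2,3) by (auto simp: image_iff) metis
  moreover have "bounded (K ` B)" unfolding B_def
    using K(1) by (intro bounded_linear_image) (auto simp: linear_linear)
  ultimately have mB: "0 < m B \<and> m B < \<infinity>" unfolding m_def
    by (intro finite_pos) (auto simp: B_def)
  have lB: "0 < emeasure lborel B \<and> emeasure lborel B < \<infinity>" by (rule finite_pos) (auto simp: B_def)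
  \<comment> \<open>The scaling factor is read off from the unit ball, whose measure and whose
    preimage's measure are both positive and finite.\<close>
  define c where "c = enn2real (m B / emeasure lborel B)"
  have c: "ennreal c = m B / emeasure lborel B" unfolding c_def
    using mB lB by (intro ennreal_enn2real) (auto simp: less_top[symmetric] ennreal_divide_eq_top_iff)
  have "m B / emeasure lborel B > 0"
    using mB lB by (simp add: ennreal_zero_less_divide)
  then have "c > 0" using c by (metis ennreal_eq_0_iff not_le order_less_irrefl)
  moreover have "distr lborel borel L = density lborel (\<lambda>_. ennreal c)"
  proof (rule measure_eqI)
    fix A assume "A \<in> sets (distr lborel borel L)"
    then have [measurable]: "A \<in> sets borel" by simp
    have "emeasure (distr lborel borel L) A = m A"
      by (simp add: emeasure_distr m_def)
    also have "\<dots> = m A * emeasure lborel B / emeasure lborel B"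
      using lB by (intro ennreal_mult_divide_eq[symmetric]) auto
    also have "\<dots> = emeasure lborel A * ennreal c"
      by (simp add: key c ennreal_times_divide)
    also have "\<dots> = emeasure (density lborel (\<lambda>_. ennreal c)) A"
      by (simp add: emeasure_density nn_integral_cmult mult.commute)
    finally show "emeasure (distr lborel borel L) A = emeasure (density lborel (\<lambda>_. ennreal c)) A" .
  qed simp
  ultimately show ?thesis using that by blast
qed

text \<open>The change of variables multiplies the integral by some positive constant, and
  positivity is enough to transfer vanishing.\<close>

lemma integral_lborel_linear_eq_0:
  fixes L :: "'a::euclidean_space \<Rightarrow> 'a" and f :: "'a \<Rightarrow> complex"
  assumes "linear L" "inj L" and [measurable]: "f \<in> borel_measurable borel"
    and "(LINT x|lborel. f (L x)) = 0"
  shows "(LINT x|lborel. f x) = 0"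
proof -
  have "L \<in> borel_measurable borel"
    using assms(1) by (intro borel_measurable_continuous_onI linear_continuous_on) (simp add: linear_linear)
  then have [measurable]: "L \<in> lborel \<rightarrow>\<^sub>M borel" by simp
  obtain c :: real where c: "c > 0" "distr lborel borel L = density lborel (\<lambda>_. ennreal c)"
    using lborel_distr_linear[OF assms(1,2)] by blast
  have "0 = (LINT x|distr lborel borel L. f x)"
    using assms(4) by (subst integral_distr) auto
  also have "\<dots> = c *\<^sub>R (LINT x|lborel. f x)"
    unfolding c(2) using c(1) by (subst integral_density) auto
  finally show ?thesis using c(1) by simp
qed

lemma integral_lborel_translate:
  fixes c :: "'a::euclidean_space" and f :: "'a \<Rightarrow> complex"
  assumes [measurable]: "f \<in> borel_measurable borel"
  shows "(LINT x|lborel. f (c + x)) = (LINT x|lborel. f x)"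
  by (subst (2) lborel_distr_plus[of c, symmetric], subst integral_distr) auto

section \<open>Polytopes\<close>

lemma set_integrable_exp_convex_hull:
  fixes T :: "'a::euclidean_space set"
  assumes "finite T"
  shows "set_integrable lborel (convex hull T) (\<lambda>x. exp (\<i> * of_real (\<xi> \<bullet> x)))"
  unfolding set_integrable_def
  using assms by (intro borel_integrable_compact finite_imp_compact_convex_hull) (auto intro!: continuous_intros)

text \<open>The simplex is the image of the standard one under \<open>x \<mapsto> t + L x\<close>.
  The frequency pulls back to a vector whose coordinates are the differences
  \<open>\<xi> \<bullet> \<beta> b - \<xi> \<bullet> t\<close>; these are distinct, nonzero and have
  exponential \<open>1\<close>.\<close>

lemma integral_simplex_eq_0:
  fixes T :: "'a::euclidean_space set"
  assumes T: "finite T" "\<not> affine_dependent T" "card T = DIM('a) + 1"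
    and exp1: "\<And>v. v \<in> T \<Longrightarrow> exp (\<i> * of_real (\<xi> \<bullet> v)) = 1"
    and inj: "inj_on (\<lambda>v. \<xi> \<bullet> v) T"
  shows "(LINT x:convex hull T|lborel. exp (\<i> * of_real (\<xi> \<bullet> x))) = 0"
proof -
  obtain t where t: "t \<in> T" using T(3) by fastforce
  have "card (T - {t}) = card (Basis :: 'a set)" using T t by simp
  then obtain \<beta> where \<beta>: "bij_betw \<beta> (Basis :: 'a set) (T - {t})"
    using T(1) by (metis finite_Basis finite_Diff finite_same_card_bij)
  then have \<beta>_mem: "\<beta> b \<in> T" "\<beta> b \<noteq> t" if "b \<in> Basis" for b
    using that by (auto dest!: bij_betwE)
  \<comment> \<open>\<open>L\<close> sends the basis vectors to the edge vectors at
    \<open>t\<close>; affine independence of \<open>T\<close> makes it injective.\<close>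
  define L where "L x = (\<Sum>b\<in>Basis. (x \<bullet> b) *\<^sub>R (\<beta> b - t))" for x
  have lin: "linear L"
    by (intro linearI) (auto simp: L_def inner_add_left scaleR_add_left sum.distrib scaleR_sum_right)
  have L_Basis: "L b = \<beta> b - t" if "b \<in> Basis" for b
    using that 
    by (simp add: L_def inner_Basis if_distrib[where f = "\<lambda>c. c *\<^sub>R _"] if_distribR sum.delta cong: if_cong)
  have "L ` Basis = (\<lambda>b. \<beta> b - t) ` Basis" using L_Basis by (rule image_cong[OF refl])
  also have "\<dots> = (\<lambda>x. x - t) ` (T - {t})" 
    unfolding bij_betw_imp_surj_on[OF \<beta>, symmetric] image_image ..
  finally have image: "L ` Basis = (\<lambda>x. x - t) ` (T - {t})" .
  have "inj L"
  proof -
    have "independent (L ` Basis)"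
      unfolding image using affine_dependent_iff_dependent2[OF t] T(2) by simp
    moreover have "inj_on L Basis"
      using \<beta> by (auto simp: inj_on_def bij_betw_def L_Basis)
    ultimately show ?thesis
      using linear_inj_on_span_independent_image[OF lin, of Basis] by simp
  qed
  have "T = (+) t ` L ` insert 0 Basis"
    using t linear_0[OF lin] by (auto simp: image image_image)
  then have hull: "convex hull T = (+) t ` L ` (convex hull (insert 0 Basis))"
    by (metis convex_hull_translation convex_hull_linear_image[OF lin])
  have mem: "t + L x \<in> convex hull T \<longleftrightarrow> x \<in> convex hull (insert 0 Basis)" for x
    unfolding hull using \<open>inj L\<close> by (auto simp: inj_image_mem_iff image_iff inj_eq)
  define f where "f x = indicator (convex hull T) x *\<^sub>R exp (\<i> * of_real (\<xi> \<bullet> x))" for x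
  have "convex hull T \<in> sets borel"
    using T(1) by (simp add: borel_compact finite_imp_compact_convex_hull)
  then have [measurable]: "f \<in> borel_measurable borel" unfolding f_def by measurable
  define c where "c = adjoint L \<xi>"
  have c: "c \<bullet> x = \<xi> \<bullet> L x" for x unfolding c_def by (simp add: adjoint_works lin adjoint_clauses)
  have "(LINT x|lborel. f (t + L x)) =
      (LINT x|lborel. exp (\<i> * of_real (\<xi> \<bullet> t)) * (indicator (convex hull (insert 0 Basis)) x *\<^sub>R
         exp (\<i> * of_real (c \<bullet> x))))"
    unfolding f_def c
    by (intro Bochner_Integration.integral_cong)
      (auto simp: indicator_def mem inner_add_right distrib_left exp_add)
  also have "\<dots> = exp (\<i> * of_real (\<xi> \<bullet> t)) *
      (LINT x:convex hull (insert 0 Basis)|lborel. exp (\<i> * of_real (c \<bullet> x)))"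
    unfolding set_lebesgue_integral_def by (rule integral_mult_right_zero)
  also have "(LINT x:convex hull (insert 0 Basis)|lborel. exp (\<i> * of_real (c \<bullet> x))) = 0"
  proof (rule integral_std_simplex_eq_0)
    show "inj_on (\<lambda>b. c \<bullet> b) Basis"
    proof (rule inj_onI)
      fix a b :: 'a assume ab: "a \<in> Basis" "b \<in> Basis" "c \<bullet> a = c \<bullet> b"
      then have "\<xi> \<bullet> \<beta> a = \<xi> \<bullet> \<beta> b" by (simp add: c L_Basis inner_diff_right)
      then have "\<beta> a = \<beta> b" using inj \<beta>_mem ab by (auto dest: inj_onD)
      then show "a = b" using \<beta> ab by (auto simp: bij_betw_def dest: inj_onD)
    qed
    fix b :: 'a assume b: "b \<in> Basis"
    have "\<xi> \<bullet> \<beta> b \<noteq> \<xi> \<bullet> t" using inj \<beta>_mem[OF b] t by (auto dest: inj_onD)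
    then show "c \<bullet> b \<noteq> 0" using b by (simp add: c L_Basis inner_diff_right)
    show "exp (\<i> * of_real (c \<bullet> b)) = 1"
      using b exp1[OF \<beta>_mem(1)[OF b]] exp1[OF t]
      by (simp add: c L_Basis inner_diff_right right_diff_distrib exp_diff)
  qed
  finally have "(LINT x|lborel. f (t + L x)) = 0" by simp
  moreover have "(\<lambda>x. f (t + x)) \<in> borel_measurable borel" by measurable
  ultimately have "(LINT x|lborel. f (t + x)) = 0"
    using integral_lborel_linear_eq_0[OF lin \<open>inj L\<close>] by blast
  then have "(LINT x|lborel. f x) = 0" by (subst (asm) integral_lborel_translate) measurable
  then show ?thesis by (simp only: f_def set_lebesgue_integral_def)
qed

text \<open>Sum over a triangulation: full-dimensional cells contribute zero by
  \<open>integral_simplex_eq_0\<close>, and both smaller cells and overlaps are null sets.\<close>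

lemma integral_convex_hull_eq_0:
  fixes S :: "'a::euclidean_space set"
  assumes S: "finite S" and exp1: "\<And>v. v \<in> S \<Longrightarrow> exp (\<i> * of_real (\<xi> \<bullet> v)) = 1"
    and inj: "inj_on (\<lambda>v. \<xi> \<bullet> v) S"
  shows "(LINT x:convex hull S|lborel. exp (\<i> * of_real (\<xi> \<bullet> x))) = 0"
proof -
  define f where "f x = exp (\<i> * complex_of_real (\<xi> \<bullet> x))" for x
  obtain \<G> where \<G>: "\<And>T. T \<in> \<G> \<Longrightarrow> T \<subseteq> S" "\<And>T. T \<in> \<G> \<Longrightarrow> \<not> affine_dependent T"
    "convex hull S = (\<Union>T\<in>\<G>. convex hull T)"
    "\<And>T T'. T \<in> \<G> \<Longrightarrow> T' \<in> \<G> \<Longrightarrow> convex hull T \<inter> convex hull T' \<subseteq> convex hull (T \<inter> T')"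
    using convex_hull_triangulation[OF S] by blast
  have fin: "finite T" if "T \<in> \<G>" for T using \<G>(1)[OF that] S finite_subset by blast
  have card: "card T \<le> DIM('a) + 1" if "T \<in> \<G>" for T
    using affine_dependent_biggerset[of T] fin[OF that] \<G>(2)[OF that] by linarith
  have negl: "negligible (convex hull T)" if "finite T" "card T \<le> DIM('a)" for T :: "'a set"
    using that by (simp add: negligible_convex_interior empty_interior_convex_hull)
  have "(f has_integral 0) (convex hull T)" if T: "T \<in> \<G>" for T
  proof (cases "card T \<le> DIM('a)")
    case True
    then show ?thesis using negl[OF fin[OF T]] by (intro has_integral_negligible[of "convex hull T"]) auto
  next
    case False
    then have "(LINT x:convex hull T|lborel. f x) = 0"
      unfolding f_def using T \<G>(1)[OF T] card[OF T] fin[OF T] \<G>(2)[OF T] exp1 inj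
      by (intro integral_simplex_eq_0) (auto intro: inj_on_subset)
    moreover have "set_integrable lborel (convex hull T) f"
      unfolding f_def using set_integrable_exp_convex_hull fin[OF T] .
    ultimately show ?thesis
      using set_borel_integral_eq_integral by (metis has_integral_integral)
  qed
  \<comment> \<open>The family is indexed by the hulls themselves, so two members to be compared
    differ as sets and hence have different vertex sets.\<close>
  moreover have "finite ((hull) convex ` \<G>)"
    using \<G>(1) S by (meson PowI finite_Pow_iff finite_imageI finite_subset subsetI)
  moreover have "pairwise (\<lambda>A B. negligible (A \<inter> B)) ((hull) convex ` \<G>)"
  proof (rule pairwiseI, clarify)
    fix T T' assume T: "T \<in> \<G>" "T' \<in> \<G>" and ne: "convex hull T \<noteq> convex hull T'"
    \<comment> \<open>A proper subset of a set of at most \<open>DIM('a) + 1\<close> vertices has at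
      most \<open>DIM('a)\<close> points, so its hull is null.\<close>
    have "T \<inter> T' \<subset> T \<or> T \<inter> T' \<subset> T'" using ne by auto
    then have "card (T \<inter> T') < card T \<or> card (T \<inter> T') < card T'"
      using fin T psubset_card_mono by blast
    then have "card (T \<inter> T') \<le> DIM('a)" using card T by fastforce
    then have "negligible (convex hull (T \<inter> T'))" using negl fin T by auto
    then show "negligible (convex hull T \<inter> convex hull T')"
      using \<G>(4)[OF T] negligible_subset by blast
  qed
  ultimately have "(f has_integral (\<Sum>A\<in>(hull) convex ` \<G>. 0)) (\<Union>((hull) convex ` \<G>))"
    by (intro has_integral_Union) auto
  then have "integral (convex hull S) f = 0" using \<G>(3) by (simp add: integral_unique)
  then show ?thesis
    using set_borel_integral_eq_integral(2)[OF set_integrable_exp_convex_hull[OF S]]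
    by (simp add: f_def[abs_def])
qed

section \<open>Choice of the frequencies\<close>

text \<open>Induction on \<open>W\<close>: pass from \<open>u\<close> to \<open>n u + e\<close>,
  where \<open>e\<close> is a basis vector not orthogonal to the new \<open>w\<close>. Each vector
  rules out at most one \<open>n\<close>, apart from the case where \<open>u\<close> is orthogonal
  to it, and then \<open>e\<close> alone suffices.\<close>

lemma integer_vector_avoiding_hyperplanes:
  fixes W :: "'a::euclidean_space set"
  assumes "finite W" "0 \<notin> W"
  obtains u where "\<And>b. b \<in> Basis \<Longrightarrow> u \<bullet> b \<in> \<int>" "\<And>w. w \<in> W \<Longrightarrow> u \<bullet> w \<noteq> 0"
proof -
  have "\<exists>u. (\<forall>b\<in>Basis. u \<bullet> b \<in> \<int>) \<and> (\<forall>w\<in>W. u \<bullet> w \<noteq> 0)"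
    using assms
  proof (induction W rule: finite_induct)
    case empty
    show ?case by (intro exI[of _ 0]) auto
  next
    case (insert w W)
    then obtain u where u: "\<forall>b\<in>Basis. u \<bullet> b \<in> \<int>" "\<forall>w\<in>W. u \<bullet> w \<noteq> 0" by auto
    have "w \<noteq> 0" using insert.prems by auto
    then obtain e where e: "e \<in> Basis" "e \<bullet> w \<noteq> 0"
      by (metis euclidean_all_zero_iff inner_commute)
    \<comment> \<open>These ratios are the bad values of \<open>n\<close>. If
      \<open>u \<bullet> w = 0\<close>, division by zero yields \<open>0\<close>, which merely
      excludes \<open>n = 0\<close>.\<close>
    have "finite ((\<lambda>x. - (e \<bullet> x) / (u \<bullet> x)) ` insert w W)" using insert.hyps by simp
    then obtain n :: nat where "of_nat n \<notin> (\<lambda>x. - (e \<bullet> x) / (u \<bullet> x)) ` insert w W"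
      using infinite_UNIV_char_0 finite_imageD[of "of_nat :: nat \<Rightarrow> real" UNIV] inj_of_nat
      by (metis finite_subset image_subsetI)
    then have n: "real n \<noteq> - (e \<bullet> x) / (u \<bullet> x)" if "x \<in> insert w W" for x using that by blast
    have "(real n *\<^sub>R u + e) \<bullet> b \<in> \<int>" if "b \<in> Basis" for b
      using that u(1) e(1) by (auto simp: inner_add_left inner_Basis intro!: Ints_add Ints_mult)
    moreover have "(real n *\<^sub>R u + e) \<bullet> x \<noteq> 0" if "x \<in> insert w W" for x
    proof (cases "u \<bullet> x = 0")
      case True
      then have "x = w" using that u(2) by auto
      then show ?thesis using True e(2) by (simp add: inner_add_left)
    next
      case False
      then show ?thesis using n[OF that] by (simp add: inner_add_left field_simps)
    qed
    ultimately show ?case by blast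
  qed
  then show ?thesis using that by blast
qed

lemma common_denominator:
  fixes X :: "real set"
  assumes "finite X" "X \<subseteq> \<rat>"
  obtains q :: nat where "q > 0" "\<And>x. x \<in> X \<Longrightarrow> real q * x \<in> \<int>"
proof -
  have "\<exists>q::nat. q > 0 \<and> (\<forall>x\<in>X. real q * x \<in> \<int>)"
    using assms
  proof (induction X rule: finite_induct)
    case empty
    show ?case by auto
  next
    case (insert x X)
    then obtain q :: nat where q: "q > 0" "\<forall>x\<in>X. real q * x \<in> \<int>" by auto
    obtain a and b :: nat where ab: "b > 0" "x = of_int a / of_nat b"
      using insert.prems by (metis Rats_cases' insert_subset of_int_of_nat_eq zero_less_imp_eq_int of_nat_0_less_iff)
    have "real (q * b) * x = of_int (int q * a)" using ab by simp
    then have "real (q * b) * x \<in> \<int>" by (metis Ints_of_int)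
    moreover have "real (q * b) * y \<in> \<int>" if "y \<in> X" for y
    proof -
      have "real (q * b) * y = of_nat b * (real q * y)" by simp
      then show ?thesis using q(2) that by (metis Ints_mult Ints_of_nat)
    qed
    ultimately show ?case using q(1) ab(1) by (intro exI[of _ "q * b"]) auto
  qed
  then show ?thesis using that by blast
qed

theorem theorem2p1:
  fixes P :: "(real ^ 'n) set"
  assumes "convex_polytope P"
    and "simple_polytope P"
    and "rational_polytope P"
  shows "\<exists>\<Lambda> :: (real ^ 'n) set. infinite \<Lambda> \<and> countable \<Lambda> \<and>
           (\<forall>\<mu>\<in>\<Lambda>. \<forall>\<nu>\<in>\<Lambda>. \<mu> \<noteq> \<nu> \<longrightarrow>
              (LINT x:P|lborel. exp (\<i> * complex_of_real ((\<mu> - \<nu>) \<bullet> x))) = 0)"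
proof -
  define S where "S = {v. v extreme_point_of P}"
  have "polytope P" using assms(1) by (simp add: convex_polytope_def)
  then have P: "P = convex hull S"
    unfolding S_def by (intro Krein_Milman_Minkowski polytope_imp_compact polytope_imp_convex)
  have fin: "finite S"
    unfolding S_def using \<open>polytope P\<close>
    by (intro finite_polyhedron_extreme_points polytope_imp_polyhedron)
  \<comment> \<open>An arbitrary nonzero vector; placing it in \<open>W\<close> forces
    \<open>u \<noteq> 0\<close>. The other members of \<open>W\<close>, differences of distinct
    vertices, make \<open>u\<close> separate the vertices.\<close>
  define e :: "real ^ 'n" where "e = axis undefined 1"
  define W where "W = insert e ((\<lambda>(v, w). v - w) ` (S \<times> S) - {0})"
  have "finite W" "0 \<notin> W" using fin by (auto simp: W_def e_def axis_eq_0_iff)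
  then obtain u where u: "\<And>b. b \<in> Basis \<Longrightarrow> u \<bullet> b \<in> \<int>" "\<And>w. w \<in> W \<Longrightarrow> u \<bullet> w \<noteq> 0"
    using integer_vector_avoiding_hyperplanes by blast
  have "u \<noteq> 0" using u(2)[of e] by (auto simp: W_def)
  have rat: "u \<bullet> v \<in> \<rat>" if "v \<in> S" for v
  proof -
    have "u $ i \<in> \<rat>" for i
      using u(1)[of "axis i 1"] Ints_subset_Rats by (auto simp: inner_axis axis_in_Basis_iff)
    moreover have "v $ i \<in> \<rat>" for i
      using assms(3) that by (simp add: rational_polytope_def S_def)
    ultimately show ?thesis by (simp add: inner_vec_def Rats_sum)
  qed
  obtain q :: nat where q: "q > 0" "\<And>x. x \<in> (\<lambda>v. u \<bullet> v) ` S \<Longrightarrow> real q * x \<in> \<int>"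
    using common_denominator[of "(\<lambda>v. u \<bullet> v) ` S"] fin rat by blast
  \<comment> \<open>A difference \<open>g k - g l\<close> is an integer multiple of
    \<open>2 * pi * q * u\<close>, so its product with each vertex lies in \<open>2 * pi\<close>
    times the integers. For \<open>k \<noteq> l\<close> the multiple is nonzero and still separates
    the vertices.\<close>
  define g where "g k = (2 * pi * real q * real k) *\<^sub>R u" for k :: nat
  have "inj g" using q(1) \<open>u \<noteq> 0\<close> by (auto simp: inj_def g_def)
  have "(LINT x:P|lborel. exp (\<i> * complex_of_real ((g k - g l) \<bullet> x))) = 0" if "g k \<noteq> g l" for k l
    unfolding P
  proof (rule integral_convex_hull_eq_0[OF fin])
    have \<xi>: "(g k - g l) \<bullet> x = 2 * pi * ((real k - real l) * (real q * (u \<bullet> x)))" for x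
      by (simp add: g_def inner_diff_left algebra_simps)
    have "k \<noteq> l" using that by auto
    show "exp (\<i> * of_real ((g k - g l) \<bullet> v)) = 1" if "v \<in> S" for v
    proof -
      have "(real k - real l) * (real q * (u \<bullet> v)) \<in> \<int>" using q(2) that by auto
      then obtain m where "(real k - real l) * (real q * (u \<bullet> v)) = of_int m" by (auto elim: Ints_cases)
      then have "\<i> * of_real ((g k - g l) \<bullet> v) = of_int (2 * m) * pi * \<i>" unfolding \<xi> by simp
      then show ?thesis using exp_eq_1 by (simp add: exp_eq_1)
    qed
    show "inj_on (\<lambda>v. (g k - g l) \<bullet> v) S"
    proof (rule inj_onI)
      fix v w assume vw: "v \<in> S" "w \<in> S" "(g k - g l) \<bullet> v = (g k - g l) \<bullet> w"
      then have "u \<bullet> (v - w) = 0"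
        using \<open>k \<noteq> l\<close> q(1) unfolding \<xi> by (simp add: inner_diff_right)
      then show "v = w" using u(2)[of "v - w"] vw(1,2) by (auto simp: W_def)
    qed
  qed
  moreover have "infinite (range g)" using \<open>inj g\<close> range_inj_infinite by blast
  ultimately show ?thesis by (intro exI[of _ "range g"]) auto
qed

end
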